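(* Let $(a,b)\subset\mathbb{R}$ be a finite interval, let $N\ge 1$ be an integer, and let $(K_{\lambda,m})_{\lambda\in\Lambda,\,1\le m\le N}$ be a family of non-negative kernels belonging to Class A on $(a,b)$, with associated constants $C_1,\dots,C_N$. Suppose that $f\in L_1(a,b)$ and that $f$ is bounded on $(a,b)$. Put $$L_\lambda(f,x)=\sum_{m=1}^{N}\int_a^b f^m(t)\,K_{\lambda,m}(x,t)\,dt .$$ Then $$\lim_{\lambda\to\infty}L_\lambda(f,x_0)=\sum_{m=1}^{N}C_m f^m(x_0)$$ holds at every Lebesgue point $x_0\in(a,b)$ of $f$.
   Context: $f$ is a real-valued function, and $f^m(t)=(f(t))^m$ denotes the $m$-th power. $\Lambda\subset\mathbb{R}$ is a set of real parameters, unbounded above, and limits are taken as $\lambda\to\infty$ in $\Lambda$. Class A on $(a,b)$: a family of functions $K_{\lambda,m}:\mathbb{R}\times\mathbb{R}\to\mathbb{R}$ ($\lambda\in\Lambda$, $1\le m\le N$) belongs to Class A if: (a) $K_{\lambda,m}(x,t)$ is non-negative and defined for all $t\in(a,b)$ and all $\lambda\in\Lambda$; (b) for any fixed $x\in(a,b)$, as a function of $t$, $K_{\lambda,m}(x,t)$ is non-decreasing on $[a,x]$ and non-increasing on $[x,b]$; (c) for any fixed $x\in(a,b)$ and every $m$, $\lim_{\lambda\to\infty}\int_a^b K_{\lambda,m}(x,t)\,dt=C_m$, where $C_m$ is a (finite) real constant; (d) for every $1\le m\le N$, every fixed $x\in(a,b)$ and every $y\in(a,b)$ with $y\neq x$,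 $\lim_{\lambda\to\infty}K_{\lambda,m}(x,y)=0$. A point $x_0\in(a,b)$ is a Lebesgue point of $f$ if for every $\varepsilon>0$ there is $\delta>0$ such that for all $0<h\le\delta$, $\int_{x_0}^{x_0+h}|f(t)-f(x_0)|\,dt<\varepsilon h$ and $\int_{x_0-h}^{x_0}|f(t)-f(x_0)|\,dt<\varepsilon h$. *)

theory Defs
  imports "HOL-Analysis.Analysis"
begin

definition lim_filter :: "real set \<Rightarrow> real filter" where
  "lim_filter \<Lambda> = inf at_top (principal \<Lambda>)"

text \<open>
  The argument order is \<open>K l m x t\<close> for the kernel with parameter \<open>l\<close> and index \<open>m\<close>
  evaluated at \<open>(x, t)\<close>; the constants \<open>C m\<close> are a parameter of the predicate, and the
  limit condition determines them for \<open>1 \<le> m \<le> N\<close> when \<open>\<Lambda>\<close> is unbounded above.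
  Integrability of the kernels on \<open>(a, b)\<close> need not be assumed: by the
  monotonicity conditions they are measurable and bounded there.
\<close>

definition class_A ::
  "real \<Rightarrow> real \<Rightarrow> real set \<Rightarrow> nat \<Rightarrow> (real \<Rightarrow> nat \<Rightarrow> real \<Rightarrow> real \<Rightarrow> real) \<Rightarrow> (nat \<Rightarrow> real) \<Rightarrow> bool"
where
  "class_A a b \<Lambda> N K C \<longleftrightarrow>
     (\<forall>l\<in>\<Lambda>. \<forall>m\<in>{1..N}. \<forall>x\<in>{a<..<b}. \<forall>t\<in>{a<..<b}. 0 \<le> K l m x t) \<and>
     (\<forall>l\<in>\<Lambda>. \<forall>m\<in>{1..N}. \<forall>x\<in>{a<..<b}.
        mono_on {a..x} (K l m x) \<and> antimono_on {x..b} (K l m x)) \<and>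
     (\<forall>m\<in>{1..N}. \<forall>x\<in>{a<..<b}.
        ((\<lambda>l. LINT t:{a<..<b}|lebesgue. K l m x t) \<longlongrightarrow> C m) (lim_filter \<Lambda>)) \<and>
     (\<forall>m\<in>{1..N}. \<forall>x\<in>{a<..<b}. \<forall>y\<in>{a<..<b}. y \<noteq> x \<longrightarrow>
        ((\<lambda>l. K l m x y) \<longlongrightarrow> 0) (lim_filter \<Lambda>))"

text \<open>
  Since \<open>\<delta>\<close> may be decreased, only values of \<open>f\<close> inside \<open>(a, b)\<close> matter; if \<open>f\<close> is
  integrable on \<open>(a, b)\<close>, the integrals over small intervals around \<open>x0\<close> are genuine ones
  and not the default value \<open>0\<close>.
\<close>

definition lebesgue_point :: "real \<Rightarrow> real \<Rightarrow> (real \<Rightarrow> real) \<Rightarrow> real \<Rightarrow> bool" where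
  "lebesgue_point a b f x0 \<longleftrightarrow> x0 \<in> {a<..<b} \<and>
     (\<forall>\<epsilon>>0. \<exists>\<delta>>0. \<forall>h. 0 < h \<and> h \<le> \<delta> \<longrightarrow>
        (LINT t:{x0..x0 + h}|lebesgue. \<bar>f t - f x0\<bar>) < \<epsilon> * h \<and>
        (LINT t:{x0 - h..x0}|lebesgue. \<bar>f t - f x0\<bar>) < \<epsilon> * h)"

definition L_operator ::
  "real \<Rightarrow> real \<Rightarrow> nat \<Rightarrow> (real \<Rightarrow> nat \<Rightarrow> real \<Rightarrow> real \<Rightarrow> real) \<Rightarrow> real \<Rightarrow> (real \<Rightarrow> real) \<Rightarrow> real \<Rightarrow> real"
where
  "L_operator a b N K l f x = (\<Sum>m=1..N. LINT t:{a<..<b}|lebesgue. f t ^ m * K l m x t)"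

end

theory Submission
  imports Defs
begin

text \<open>
  Put \<open>g t = \<bar>f t - f x0\<bar>\<close>. As \<open>f\<close> is bounded, \<open>\<bar>f t ^ m - f x0 ^ m\<bar>\<close> is at most a constant times
  \<open>g t\<close>, so it suffices that \<open>\<integral> g k \<rightarrow> 0\<close> for each kernel \<open>k = K l m x0\<close>. Near \<open>x0\<close> all integrals of
  \<open>g - \<epsilon>\<close> over intervals with endpoint \<open>x0\<close> are nonpositive; by the second mean value theorem this
  persists after multiplication by the unimodal weight \<open>k\<close>, so the local part of \<open>\<integral> g k\<close> is at most
  \<open>\<epsilon> \<integral> k\<close>. Away from \<open>x0\<close>, \<open>k\<close> is dominated by \<open>k (x0 - d) + k (x0 + d)\<close>, which tends to \<open>0\<close>.
\<close>

section \<open>Sign of integrals against monotone weights\<close>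

text \<open>The second mean value theorem replaces \<open>k\<close> by its two end values, switching
  at some \<open>y\<close>. Regrouping gives \<open>k c\<close> times the integral over all of
  \<open>{c..d}\<close> plus \<open>k d - k c\<close> times the tail from \<open>y\<close>:
  nonnegative coefficients times nonpositive tails.\<close>

lemma integral_mono_weight_nonpos:
  fixes g k :: "real \<Rightarrow> real"
  assumes "c \<le> d" "mono_on {c..d} k" "0 \<le> k c" "g integrable_on {c..d}"
    and tail: "\<And>y. y \<in> {c..d} \<Longrightarrow> integral {y..d} g \<le> 0"
  shows "integral {c..d} (\<lambda>t. k t * g t) \<le> 0"
proof -
  have mono: "\<And>x y. \<lbrakk>c \<le> x; x \<le> y; y \<le> d\<rbrakk> \<Longrightarrow> k x \<le> k y"
    using assms(2) by (auto simp: mono_on_def)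
  obtain y where y: "y \<in> {c..d}" and
    hi: "((\<lambda>t. k t * g t) has_integral (k c * integral {c..y} g + k d * integral {y..d} g)) {c..d}"
    using second_mean_value_theorem_full[where g = k, OF assms(4,1) mono] by blast
  have "integral {c..y} g + integral {y..d} g = integral {c..d} g"
    using y assms(4) by (intro Henstock_Kurzweil_Integration.integral_combine) auto
  then have "k c * integral {c..y} g + k d * integral {y..d} g
      = k c * integral {c..d} g + (k d - k c) * integral {y..d} g"
    by (simp add: algebra_simps flip: distrib_left)
  also have "\<dots> \<le> 0"
    using tail[OF y] tail[of c] mono[of c d] assms(1,3)
    by (intro add_nonpos_nonpos mult_nonneg_nonpos) auto
  finally show "integral {c..d} (\<lambda>t. k t * g t) \<le> 0"
    using hi by (simp add: integral_unique)
qed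

text \<open>The reflection of \<open>t\<close> to \<open>-t\<close> turns initial intervals into
  tails and reduces this to the non-decreasing case.\<close>

lemma integral_antimono_weight_nonpos:
  fixes g k :: "real \<Rightarrow> real"
  assumes "c \<le> d" "antimono_on {c..d} k" "0 \<le> k d" "g integrable_on {c..d}"
    and initial: "\<And>y. y \<in> {c..d} \<Longrightarrow> integral {c..y} g \<le> 0"
  shows "integral {c..d} (\<lambda>t. k t * g t) \<le> 0"
proof -
  have mono: "mono_on {-d..-c} (\<lambda>t. k (-t))"
    using assms(2) by (auto simp: monotone_on_def)
  have int: "(\<lambda>t. g (-t)) integrable_on {-d..-c}"
    using assms(4) by simp
  have tail: "integral {y..-c} (\<lambda>t. g (-t)) \<le> 0" if "y \<in> {-d..-c}" for y
    using initial[of "-y"] that Henstock_Kurzweil_Integration.integral_reflect_real[where f = g and a = c and b = "-y"] by auto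
  show "integral {c..d} (\<lambda>t. k t * g t) \<le> 0"
    using integral_mono_weight_nonpos[OF _ mono _ int tail] assms(1,3)
      Henstock_Kurzweil_Integration.integral_reflect_real[where f = "\<lambda>t. k t * g t" and a = c and b = d]
    by simp
qed

section \<open>Estimates for a single unimodal weight\<close>

locale unimodal_weight =
  fixes a b x :: real and k :: "real \<Rightarrow> real"
  assumes x: "a < x" "x < b"
    and nonneg: "\<And>t. t \<in> {a<..<b} \<Longrightarrow> 0 \<le> k t"
    and mono: "mono_on {a..x} k"
    and antimono: "antimono_on {x..b} k"
begin

text \<open>A monotone function on a compact interval is integrable; the two halves meet at the peak
  \<open>x\<close>.\<close>

lemma absolutely_integrable: "k absolutely_integrable_on {a<..<b}"
proof -
  have "integrable (lebesgue_on {a..x}) k"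
    using mono by (rule integrable_mono_on)
  then have 1: "k absolutely_integrable_on {a..x}"
    by (simp add: set_integrable_def integrable_restrict_space)
  have "mono_on {x..b} (\<lambda>t. - k t)"
    using antimono by (auto simp: monotone_on_def)
  then have "integrable (lebesgue_on {x..b}) (\<lambda>t. - k t)"
    by (rule integrable_mono_on)
  then have 2: "k absolutely_integrable_on {x..b}"
    by (simp add: set_integrable_def integrable_restrict_space)
  have "k absolutely_integrable_on {a..x} \<union> {x..b}"
    using 1 2 by (intro set_integrable_Un) auto
  then show ?thesis
    by (rule set_integrable_subset) auto
qed

lemma measurable: "k \<in> borel_measurable (lebesgue_on {a<..<b})"
  using absolutely_integrable by (simp add: absolutely_integrable_measurable)

lemma bounded: "bounded (k ` {a<..<b})"
proof -
  have "k t \<le> k x" if "t \<in> {a<..<b}" for t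
    using that x mono antimono by (cases "t \<le> x") (auto simp: monotone_on_def)
  then show ?thesis
    using nonneg by (intro boundedI[of _ "k x"]) auto
qed

lemma absolutely_integrable_mult:
  "g absolutely_integrable_on {a<..<b} \<Longrightarrow> (\<lambda>t. k t * g t) absolutely_integrable_on {a<..<b}"
  using measurable bounded by (intro absolutely_integrable_bounded_measurable_product_real) auto

text \<open>The quantitative core: the bound involves \<open>k\<close> only through its total
  integral and its values at two points other than \<open>x\<close>, exactly the quantities whose
  limits Class A prescribes.\<close>

lemma weighted_integral_le:
  fixes g :: "real \<Rightarrow> real"
  assumes g: "g absolutely_integrable_on {a<..<b}" "\<And>t. t \<in> {a<..<b} \<Longrightarrow> 0 \<le> g t"
    and d: "0 < d" "a < x - d" "x + d < b" and "0 \<le> \<epsilon>"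
    and right: "\<And>h. \<lbrakk>0 < h; h \<le> d\<rbrakk> \<Longrightarrow> (LINT t:{x..x + h}|lebesgue. g t) \<le> \<epsilon> * h"
    and left: "\<And>h. \<lbrakk>0 < h; h \<le> d\<rbrakk> \<Longrightarrow> (LINT t:{x - h..x}|lebesgue. g t) \<le> \<epsilon> * h"
  shows "(LINT t:{a<..<b}|lebesgue. k t * g t)
    \<le> \<epsilon> * (LINT t:{a<..<b}|lebesgue. k t) + (k (x - d) + k (x + d)) * (LINT t:{a<..<b}|lebesgue. g t)"
proof -
  define J where "J = {x - d..x + d}"
  \<comment> \<open>With this shift, \<open>right\<close> and \<open>left\<close> say that integrals
    of \<open>q\<close> over short intervals with endpoint \<open>x\<close> are nonpositive, as the
    monotone weight lemmas require.\<close>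
  define q where "q t = g t - \<epsilon>" for t
  have J: "J \<subseteq> {a<..<b}" "J \<in> sets lebesgue"
    using d by (auto simp: J_def)
  have const: "(\<lambda>_. \<epsilon>) absolutely_integrable_on {a<..<b}"
    by (rule absolutely_integrable_on_const) auto
  have q: "q absolutely_integrable_on {a<..<b}"
    unfolding q_def using g(1) const by (rule set_integral_diff(1))
  have kg: "(\<lambda>t. k t * g t) absolutely_integrable_on {a<..<b}"
    and kq: "(\<lambda>t. k t * q t) absolutely_integrable_on {a<..<b}"
    using absolutely_integrable_mult g(1) q by auto
  have kqJ: "(\<lambda>t. k t * q t) absolutely_integrable_on J"
    using set_integrable_subset[OF kq J(2,1)] .
  have sub: "integral {u..v} q = (LINT t:{u..v}|lebesgue. g t) - \<epsilon> * (v - u)"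
    and sub': "q integrable_on {u..v}"
    if "a < u" "u \<le> v" "v < b" for u v
  proof -
    have "{u..v} \<subseteq> {a<..<b}" using that by auto
    then have gi: "g absolutely_integrable_on {u..v}"
      and qi: "q absolutely_integrable_on {u..v}"
      using g(1) q by (auto intro: set_integrable_subset)
    show "q integrable_on {u..v}"
      using qi by (rule set_lebesgue_integral_eq_integral)
    have "integral {u..v} q = integral {u..v} g - integral {u..v} (\<lambda>_. \<epsilon>)"
      unfolding q_def using gi
      by (intro Henstock_Kurzweil_Integration.integral_diff)
         (auto intro: set_lebesgue_integral_eq_integral)
    then show "integral {u..v} q = (LINT t:{u..v}|lebesgue. g t) - \<epsilon> * (v - u)"
      using gi that by (simp add: set_lebesgue_integral_eq_integral)
  qed
  have L: "integral {x - d..x} (\<lambda>t. k t * q t) \<le> 0"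
  proof (rule integral_mono_weight_nonpos)
    show "mono_on {x - d..x} k"
      using mono d by (auto simp: monotone_on_def)
    show "integral {y..x} q \<le> 0" if "y \<in> {x - d..x}" for y
      \<comment> \<open>The case \<open>y = x\<close> is separate because \<open>left\<close> needs
        a positive length; the interval is then degenerate.\<close>
      using left[of "x - y"] sub[of y x] that d x by (cases "y = x") auto
  qed (use nonneg d x sub' in auto)
  have R: "integral {x..x + d} (\<lambda>t. k t * q t) \<le> 0"
  proof (rule integral_antimono_weight_nonpos)
    show "antimono_on {x..x + d} k"
      using antimono d by (auto simp: monotone_on_def)
    show "integral {x..y} q \<le> 0" if "y \<in> {x..x + d}" for y
      using right[of "y - x"] sub[of x y] that d x by (cases "y = x") auto
  qed (use nonneg d x sub' in auto)
  have "integral J (\<lambda>t. k t * q t)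
      = integral {x - d..x} (\<lambda>t. k t * q t) + integral {x..x + d} (\<lambda>t. k t * q t)"
    unfolding J_def using d kqJ
    by (intro Henstock_Kurzweil_Integration.integral_combine[symmetric])
       (auto simp: J_def intro: set_lebesgue_integral_eq_integral)
  then have near: "(LINT t:J|lebesgue. k t * q t) \<le> 0"
    using L R kqJ by (simp add: set_lebesgue_integral_eq_integral)
  \<comment> \<open>On each side of the window the nearer end value dominates \<open>k t\<close>;
    adding the other, nonnegative one gives a single bound for both sides.\<close>
  have far: "k t * q t \<le> (k (x - d) + k (x + d)) * g t" if t: "t \<in> {a<..<b}" "t \<notin> J" for t
  proof -
    have "k t \<le> k (x - d) + k (x + d)"
    proof (cases "t < x - d")
      case True
      then have "k t \<le> k (x - d)"
        using mono t d x by (auto simp: monotone_on_def)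
      then show ?thesis using nonneg[of "x + d"] d x by auto
    next
      case False
      then have "k t \<le> k (x + d)"
        using antimono t d x by (auto simp: monotone_on_def J_def)
      then show ?thesis using nonneg[of "x - d"] d x by auto
    qed
    then have "k t * g t \<le> (k (x - d) + k (x + d)) * g t"
      using g(2) t by (intro mult_right_mono) auto
    moreover have "k t * q t \<le> k t * g t"
      using nonneg t \<open>0 \<le> \<epsilon>\<close> by (intro mult_left_mono) (auto simp: q_def)
    ultimately show ?thesis by simp
  qed
  let ?\<kappa> = "k (x - d) + k (x + d)"
  have \<kappa>: "0 \<le> ?\<kappa>"
    using nonneg d x by (intro add_nonneg_nonneg) auto
  \<comment> \<open>The indicator lets the near and far estimates merge into one pointwise
    inequality on \<open>{a<..<b}\<close>.\<close>
  have ind: "(LINT t:{a<..<b}|lebesgue. indicator J t * (k t * q t)) = (LINT t:J|lebesgue. k t * q t)"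
    unfolding set_lebesgue_integral_def using J
    by (intro Bochner_Integration.integral_cong) (auto simp: indicator_def)
  have indi: "(\<lambda>t. indicator J t * (k t * q t)) absolutely_integrable_on {a<..<b}"
  proof -
    have "(\<lambda>t. indicator {a<..<b} t *\<^sub>R (indicator J t * (k t * q t))) = (\<lambda>t. indicator J t *\<^sub>R (k t * q t))"
      using J by (auto simp: indicator_def fun_eq_iff)
    then show ?thesis using kqJ by (simp add: set_integrable_def)
  qed
  have \<kappa>g: "(\<lambda>t. ?\<kappa> * g t) absolutely_integrable_on {a<..<b}"
    using g(1) by (rule set_integrable_mult_right)
  have "(LINT t:{a<..<b}|lebesgue. k t * q t)
      \<le> (LINT t:{a<..<b}|lebesgue. indicator J t * (k t * q t) + ?\<kappa> * g t)"
  proof (rule set_integral_mono[OF kq set_integral_add(1)[OF indi \<kappa>g]])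
    fix t assume t: "t \<in> {a<..<b}"
    then have "0 \<le> ?\<kappa> * g t" using \<kappa> g(2) by simp
    then show "k t * q t \<le> indicator J t * (k t * q t) + ?\<kappa> * g t"
      using far[OF t] by (cases "t \<in> J") auto
  qed
  also have "\<dots> = (LINT t:J|lebesgue. k t * q t) + ?\<kappa> * (LINT t:{a<..<b}|lebesgue. g t)"
    by (simp add: set_integral_add(2)[OF indi \<kappa>g] ind)
  finally have "(LINT t:{a<..<b}|lebesgue. k t * q t) \<le> ?\<kappa> * (LINT t:{a<..<b}|lebesgue. g t)"
    using near by simp
  moreover have "(LINT t:{a<..<b}|lebesgue. k t * q t)
      = (LINT t:{a<..<b}|lebesgue. k t * g t) - \<epsilon> * (LINT t:{a<..<b}|lebesgue. k t)"
    using set_integral_diff(2)[OF kg set_integrable_mult_right[OF absolutely_integrable, of \<epsilon>]]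
    by (simp add: q_def algebra_simps)
  ultimately show ?thesis by simp
qed

end

section \<open>Powers of \<open>f\<close> and the limit for one index \<open>m\<close>\<close>

text \<open>Factor out \<open>y - c\<close> and bound every term of the cofactor by powers of
  \<open>B\<close>. This carries the Lebesgue point condition, which concerns \<open>f\<close>
  alone, over to its powers.\<close>

lemma abs_power_diff_le:
  fixes y c B :: real
  assumes "\<bar>y\<bar> \<le> B" "\<bar>c\<bar> \<le> B"
  shows "\<bar>y ^ m - c ^ m\<bar> \<le> (\<Sum>i<m. B ^ (m - Suc i) * B ^ i) * \<bar>y - c\<bar>"
proof -
  have "\<bar>\<Sum>i<m. c ^ (m - Suc i) * y ^ i\<bar> \<le> (\<Sum>i<m. B ^ (m - Suc i) * B ^ i)"
    using assms by (intro order_trans[OF sum_abs] sum_mono)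
      (auto simp: abs_mult power_abs intro!: mult_mono power_mono)
  then show ?thesis
    unfolding power_diff_sumr2 abs_mult by (subst mult.commute) (rule mult_right_mono, auto)
qed

lemma class_A_unimodal_weight:
  assumes "class_A a b \<Lambda> N K C" "l \<in> \<Lambda>" "m \<in> {1..N}" "x \<in> {a<..<b}"
  shows "unimodal_weight a b x (K l m x)"
  using assms unfolding class_A_def unimodal_weight_def by auto

text \<open>Freezing \<open>f\<close> at \<open>x\<close> leaves \<open>f x ^ m\<close> times the
  integral of the kernel, which has the desired limit; the error is controlled by
  \<open>weighted_integral_le\<close>.\<close>

lemma class_A_power_tendsto:
  assumes A: "class_A a b \<Lambda> N K C" and m: "m \<in> {1..N}"
    and f: "set_integrable lebesgue {a<..<b} f" and bdd: "bounded (f ` {a<..<b})"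
    and leb: "lebesgue_point a b f x"
  shows "((\<lambda>l. LINT t:{a<..<b}|lebesgue. f t ^ m * K l m x t) \<longlongrightarrow> C m * f x ^ m) (lim_filter \<Lambda>)"
proof -
  define c where "c = f x"
  define g where "g t = \<bar>f t - c\<bar>" for t
  define G where "G = (LINT t:{a<..<b}|lebesgue. g t)"
  define I where "I l = (LINT t:{a<..<b}|lebesgue. K l m x t)" for l
  define P where "P l = (LINT t:{a<..<b}|lebesgue. f t ^ m * K l m x t)" for l
  have x: "x \<in> {a<..<b}"
    using leb by (simp add: lebesgue_point_def)
  obtain B where B: "\<bar>f t\<bar> \<le> B" if "t \<in> {a<..<b}" for t
    using bdd by (force simp: bounded_iff)
  define M where "M = (\<Sum>i<m. B ^ (m - Suc i) * B ^ i)"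
  have "0 \<le> B" using B[OF x] by linarith
  then have M: "0 \<le> M" by (auto simp: M_def intro!: sum_nonneg)
  have pow: "\<bar>f t ^ m - c ^ m\<bar> \<le> M * g t" if "t \<in> {a<..<b}" for t
    unfolding M_def g_def c_def using B[OF that] B[OF x] by (rule abs_power_diff_le)
  have fc: "(\<lambda>t. f t - c) absolutely_integrable_on {a<..<b}"
    using f by (intro set_integral_diff(1) absolutely_integrable_on_const) auto
  have g: "g absolutely_integrable_on {a<..<b}"
    unfolding g_def using set_integrable_abs[OF fc] .
  have fmeas: "f \<in> borel_measurable (lebesgue_on {a<..<b})"
    using f by (simp add: absolutely_integrable_measurable)
  have "\<bar>f t ^ m\<bar> \<le> B ^ m" if "t \<in> {a<..<b}" for t
    using B[OF that] by (simp add: power_abs power_mono)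
  then have fpow: "bounded ((\<lambda>t. f t ^ m) ` {a<..<b})"
    by (intro boundedI[of _ "B ^ m"]) auto
  \<comment> \<open>Class A gives nonnegativity and monotonicity only for parameters in
    \<open>\<Lambda>\<close>.\<close>
  have ev: "eventually (\<lambda>l. l \<in> \<Lambda>) (lim_filter \<Lambda>)"
    by (auto simp: lim_filter_def eventually_inf_principal)
  have I: "(I \<longlongrightarrow> C m) (lim_filter \<Lambda>)"
    using A m x unfolding class_A_def I_def by blast
  have K0: "((\<lambda>l. K l m x y) \<longlongrightarrow> 0) (lim_filter \<Lambda>)" if "y \<in> {a<..<b}" "y \<noteq> x" for y
    using A m x that unfolding class_A_def by blast
  have "((\<lambda>l. P l - c ^ m * I l) \<longlongrightarrow> 0) (lim_filter \<Lambda>)"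
  proof (rule tendstoI)
    fix e :: real assume "0 < e"
    \<comment> \<open>The error bound will tend to \<open>M * (\<epsilon> * C m)\<close>; the
      summand 1 makes this strictly less than \<open>e\<close> and keeps the denominator
      positive.\<close>
    define \<epsilon> where "\<epsilon> = e / (M * \<bar>C m\<bar> + 1)"
    have pos: "0 < M * \<bar>C m\<bar> + 1"
      using M by (intro add_nonneg_pos) auto
    have \<epsilon>: "0 < \<epsilon>" using \<open>0 < e\<close> pos by (simp add: \<epsilon>_def)
    have "M * (\<epsilon> * C m) \<le> \<epsilon> * (M * \<bar>C m\<bar>)"
      using M \<epsilon> by (simp add: mult.left_commute mult_left_mono)
    also have "\<dots> < \<epsilon> * (M * \<bar>C m\<bar> + 1)"
      using \<epsilon> by simp
    also have "\<dots> = e" using pos by (simp add: \<epsilon>_def)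
    finally have lt: "M * (\<epsilon> * C m + (0 + 0) * G) < e" by simp
    obtain \<delta> where \<delta>: "0 < \<delta>" and leb\<delta>: "\<And>h. 0 < h \<and> h \<le> \<delta> \<Longrightarrow>
        (LINT t:{x..x + h}|lebesgue. g t) < \<epsilon> * h \<and> (LINT t:{x - h..x}|lebesgue. g t) < \<epsilon> * h"
      using leb \<epsilon> unfolding lebesgue_point_def g_def c_def by metis
    \<comment> \<open>The halves keep \<open>x - d\<close> and \<open>x + d\<close> strictly inside
      the interval, where the kernels tend to 0. The choice does not depend on \<open>l\<close>, so
      these two points stay fixed in the limit.\<close>
    define d where "d = min \<delta> (min ((x - a) / 2) ((b - x) / 2))"
    have d: "0 < d" "d \<le> \<delta>" "a < x - d" "x + d < b"
      using x \<delta> by (auto simp: d_def min_def field_simps)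
    have "((\<lambda>l. M * (\<epsilon> * I l + (K l m x (x - d) + K l m x (x + d)) * G))
        \<longlongrightarrow> M * (\<epsilon> * C m + (0 + 0) * G)) (lim_filter \<Lambda>)"
      using d x by (intro tendsto_intros I K0) auto
    then have "eventually (\<lambda>l. M * (\<epsilon> * I l + (K l m x (x - d) + K l m x (x + d)) * G) < e) (lim_filter \<Lambda>)"
      using lt by (rule order_tendstoD)
    with ev show "eventually (\<lambda>l. dist (P l - c ^ m * I l) 0 < e) (lim_filter \<Lambda>)"
    proof eventually_elim
      case (elim l)
      interpret unimodal_weight a b x "K l m x"
        using A elim(1) m x by (rule class_A_unimodal_weight)
      have fK: "(\<lambda>t. f t ^ m * K l m x t) absolutely_integrable_on {a<..<b}"
        using fmeas fpow absolutely_integrable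
        by (intro absolutely_integrable_bounded_measurable_product_real) auto
      note cK = set_integrable_mult_right[OF absolutely_integrable, of "c ^ m"]
      note D = set_integral_diff[OF fK cK]
      have "\<bar>P l - c ^ m * I l\<bar>
          = \<bar>LINT t:{a<..<b}|lebesgue. f t ^ m * K l m x t - c ^ m * K l m x t\<bar>"
        using D(2) by (simp add: P_def I_def)
      also have "\<dots> \<le> (LINT t:{a<..<b}|lebesgue. \<bar>f t ^ m * K l m x t - c ^ m * K l m x t\<bar>)"
        using set_integral_norm_bound[OF D(1)] by simp
      also have "\<dots> \<le> (LINT t:{a<..<b}|lebesgue. M * (K l m x t * g t))"
      proof (rule set_integral_mono)
        show "(\<lambda>t. \<bar>f t ^ m * K l m x t - c ^ m * K l m x t\<bar>) absolutely_integrable_on {a<..<b}"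
          using set_integrable_abs[OF D(1)] .
        show "(\<lambda>t. M * (K l m x t * g t)) absolutely_integrable_on {a<..<b}"
          using absolutely_integrable_mult[OF g] by (rule set_integrable_mult_right)
        \<comment> \<open>This is \<open>pow\<close> multiplied by the nonnegative kernel.\<close>
        show "\<bar>f t ^ m * K l m x t - c ^ m * K l m x t\<bar> \<le> M * (K l m x t * g t)"
          if t: "t \<in> {a<..<b}" for t
          using mult_right_mono[OF pow[OF t] nonneg[OF t]] nonneg[OF t]
          by (simp add: abs_mult mult_ac flip: left_diff_distrib)
      qed
      also have "\<dots> = M * (LINT t:{a<..<b}|lebesgue. K l m x t * g t)"
        by simp
      also have "\<dots> \<le> M * (\<epsilon> * I l + (K l m x (x - d) + K l m x (x + d)) * G)"
        unfolding I_def G_def using d \<epsilon> leb\<delta> M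
        by (intro mult_left_mono weighted_integral_le g) (auto simp: g_def[of t for t] less_imp_le)
      also have "\<dots> < e" by (rule elim)
      finally show ?case by simp
    qed
  qed
  from tendsto_add[OF this tendsto_mult_left[OF I, of "c ^ m"]]
  show ?thesis by (simp add: P_def c_def mult.commute)
qed

theorem theorem1:
  fixes a b :: real and \<Lambda> :: "real set" and N :: nat
    and K :: "real \<Rightarrow> nat \<Rightarrow> real \<Rightarrow> real \<Rightarrow> real" and C :: "nat \<Rightarrow> real"
    and f :: "real \<Rightarrow> real" and x0 :: real
  assumes "a < b" and "N \<ge> 1" and "\<not> bdd_above \<Lambda>"
    and "class_A a b \<Lambda> N K C"
    and "set_integrable lebesgue {a<..<b} f"
    and "bounded (f ` {a<..<b})"
    and "lebesgue_point a b f x0"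
  shows "((\<lambda>l. L_operator a b N K l f x0) \<longlongrightarrow> (\<Sum>m=1..N. C m * f x0 ^ m)) (lim_filter \<Lambda>)"
  unfolding L_operator_def
  using class_A_power_tendsto[OF assms(4) _ assms(5-7)] by (intro tendsto_sum)

end
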